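(* The following identities hold in $\widehat{\mathrm{Sh}}_0(x)$: $$\sum_{n=-\infty}^{\infty}(n^2)!\,(1\otimes x^{\otimes n^2})=\prod_{n=1}^{\infty}\big(1+(2n-1)!\,(1\otimes x^{\otimes(2n-1)})\big)^2\big(1-(2n)!\,(1\otimes x^{\otimes 2n})\big),$$ $$\sum_{n=0}^{\infty}\binom{n+1}{2}!\,\big(1\otimes x^{\otimes\binom{n+1}{2}}\big)=\prod_{n=1}^{\infty}\frac{1-(2n)!\,(1\otimes x^{\otimes 2n})}{1-(2n-1)!\,(1\otimes x^{\otimes(2n-1)})},$$ $$\sum_{n=-\infty}^{\infty}(-1)^n\Big(\frac{n(3n-1)}{2}\Big)!\,\big(1\otimes x^{\otimes\frac{n(3n-1)}{2}}\big)=\prod_{n=1}^{\infty}\big(1-n!\,(1\otimes x^{\otimes n})\big).$$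
   Context: Let $\mathrm{Sh}_0(x)=\bigoplus_{k\ge1}\mathbb{R}[x]^{\otimes k}$ (tensor products over $\mathbb{R}$), the free commutative Rota–Baxter algebra of weight $0$ on one generator $x$. It is a commutative $\mathbb{R}$-algebra with product determined bilinearly by $$(a_0\otimes a)(b_0\otimes b)=a_0b_0\otimes(a\,ш\,b),\qquad a_0,b_0\in\mathbb{R}[x],$$ where $a=a_1\otimes\cdots\otimes a_m$ and $b=b_1\otimes\cdots\otimes b_n$ ($m,n\ge0$) are pure tensors over $\mathbb{R}[x]$ and $ш$ is the shuffle product: the empty tensor is the unit for $ш$, and $(a_1\otimes a')ш(b_1\otimes b')=a_1\otimes(a'\,ш\,(b_1\otimes b'))+b_1\otimes((a_1\otimes a')\,ш\,b')$. The unit is $1\in\mathbb{R}[x]$. Let $\mathrm{Fil}^k=\bigoplus_{i\ge k}\mathbb{R}[x]^{\otimes i}$; these are ideals, and $\widehat{\mathrm{Sh}}_0(x)=\varprojlim\mathrm{Sh}_0(x)/\mathrm{Fil}^k\cong\prod_{k\ge1}\mathbb{R}[x]^{\otimes k}$ is the completion. Infinite sums and products are taken in the topology of this completion. $1\otimes x^{\otimes k}$ denotes $1\otimes x\otimes\cdots\otimes x$ with $k$ factors $x$, and $1\otimes x^{\otimes0}=1$. *)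

theory Defs
  imports "HOL-Analysis.Analysis" "HOL-Computational_Algebra.Polynomial" "HOL-Library.Multiset"
begin

section \<open>The shuffle product of words\<close>

text \<open>The library function \<^const>\<open>shuffles\<close> yields a set of words; the shuffle product has to count
  multiplicities, so a multiset is used. A multiset of words is read as a sum of pure tensors.\<close>

fun shuffle_mset :: "'a list \<Rightarrow> 'a list \<Rightarrow> 'a list multiset" where
  "shuffle_mset [] v = {#v#}"
| "shuffle_mset u [] = {#u#}"
| "shuffle_mset (a # u) (b # v) =
     image_mset ((#) a) (shuffle_mset u (b # v)) + image_mset ((#) b) (shuffle_mset (a # u) v)"

section \<open>The completed algebra as a product of tensor powers\<close>

text \<open>The \<open>k\<close>-th tensor power of \<open>\<real>[x]\<close> has the basis of monomial tensors
  \<open>x^i\<^sub>1 \<otimes> \<dots> \<otimes> x^i\<^sub>k\<close>, which is indexed by the words \<open>[i\<^sub>1, \<dots>, i\<^sub>k]\<close> of exponents. An element of it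
  is thus a finitely supported real function on words of length \<open>k\<close>, and an element of the product
  of all tensor powers with \<open>k \<ge> 1\<close> is a function on nonempty words whose restriction to each
  length has finite support. This product is the completion of its subalgebra of elements of
  finite support, the direct sum of the tensor powers. Pure tensors of arbitrary polynomials are \<open>pure_tensor\<close> below, where
  their multilinearity and the product formula for them are proved.\<close>

typedef sh_hat = "{f :: nat list \<Rightarrow> real. f [] = 0 \<and> (\<forall>k. finite {w. length w = k \<and> f w \<noteq> 0})}"
  morphisms tcoeff Abs_sh_hat
  by (rule exI[of _ "\<lambda>_. 0"]) simp

setup_lifting type_definition_sh_hat

lemma tcoeff_Nil [simp]: "tcoeff f [] = 0"
  by transfer simp

lemma finite_tcoeff: "finite {w. length w = k \<and> tcoeff f w \<noteq> 0}"
  by transfer simp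

lemma sh_hat_eqI: "(\<And>m w. tcoeff f (m # w) = tcoeff g (m # w)) \<Longrightarrow> f = g"
  by (metis ext list.exhaust tcoeff_Nil tcoeff_inject)

subsection \<open>Vector space structure\<close>

instantiation sh_hat :: real_vector
begin

lift_definition zero_sh_hat :: sh_hat is "\<lambda>_. 0" by simp

lift_definition plus_sh_hat :: "sh_hat \<Rightarrow> sh_hat \<Rightarrow> sh_hat" is "\<lambda>f g w. f w + g w"
  apply (intro conjI allI)
   apply simp
  subgoal for f g k
    by (rule finite_subset[of _ "{w. length w = k \<and> f w \<noteq> 0} \<union> {w. length w = k \<and> g w \<noteq> 0}"]) auto
  done

lift_definition uminus_sh_hat :: "sh_hat \<Rightarrow> sh_hat" is "\<lambda>f w. - f w" by simp

lift_definition minus_sh_hat :: "sh_hat \<Rightarrow> sh_hat \<Rightarrow> sh_hat" is "\<lambda>f g w. f w - g w"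
  apply (intro conjI allI)
   apply simp
  subgoal for f g k
    by (rule finite_subset[of _ "{w. length w = k \<and> f w \<noteq> 0} \<union> {w. length w = k \<and> g w \<noteq> 0}"]) auto
  done

lift_definition scaleR_sh_hat :: "real \<Rightarrow> sh_hat \<Rightarrow> sh_hat" is "\<lambda>c f w. c * f w"
  apply (intro conjI allI)
   apply simp
  subgoal for c f k
    by (rule finite_subset[of _ "{w. length w = k \<and> f w \<noteq> 0}"]) auto
  done

instance
  by standard (transfer; simp add: fun_eq_iff algebra_simps)+

end

lemma tcoeff_simps [simp]:
  "tcoeff 0 w = 0" "tcoeff (f + g) w = tcoeff f w + tcoeff g w" "tcoeff (- f) w = - tcoeff f w"
  "tcoeff (f - g) w = tcoeff f w - tcoeff g w" "tcoeff (c *\<^sub>R f) w = c * tcoeff f w"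
  by (transfer; simp)+

subsection \<open>Multiplication\<close>

text \<open>The product \<open>(x^i \<otimes> u) (x^j \<otimes> v) = x^(i + j) \<otimes> (u sh v)\<close> of monomial tensors.\<close>

fun basis_mult :: "nat list \<Rightarrow> nat list \<Rightarrow> nat list multiset" where
  "basis_mult (i # u) (j # v) = image_mset ((#) (i + j)) (shuffle_mset u v)"
| "basis_mult _ _ = {#}"

lemma length_shuffle_mset: "w \<in># shuffle_mset u v \<Longrightarrow> length w = length u + length v"
  by (induction u v arbitrary: w rule: shuffle_mset.induct) auto

lemma length_basis_mult: "w \<in># basis_mult u v \<Longrightarrow> length u + length v = length w + 1"
  by (induction u v rule: basis_mult.induct) (auto dest: length_shuffle_mset)

lemma Nil_notin_basis_mult: "[] \<notin># basis_mult u v"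
  by (induction u v rule: basis_mult.induct) auto

text \<open>Bilinear extension of \<^const>\<open>basis_mult\<close>. In degree \<open>length w\<close> only pairs of words of total
  length \<open>length w + 1\<close> contribute, so the sum ranges over a finite set.\<close>

definition mult_coeff :: "(nat list \<Rightarrow> real) \<Rightarrow> (nat list \<Rightarrow> real) \<Rightarrow> nat list \<Rightarrow> real" where
  "mult_coeff f g w =
     (\<Sum>(u, v) \<in> {(u, v). length u + length v = length w + 1 \<and> f u \<noteq> 0 \<and> g v \<noteq> 0}.
        f u * g v * real (count (basis_mult u v) w))"

lemma finite_mult_pairs:
  assumes "\<forall>k. finite {w. length w = k \<and> f w \<noteq> (0::real)}"
    and "\<forall>k. finite {w. length w = k \<and> g w \<noteq> (0::real)}"
  shows "finite {(u, v). length u + length v = n \<and> f u \<noteq> 0 \<and> g v \<noteq> 0}"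
proof (rule finite_subset)
  show "finite ((\<Union>k\<le>n. {w. length w = k \<and> f w \<noteq> 0}) \<times> (\<Union>k\<le>n. {w. length w = k \<and> g w \<noteq> 0}))"
    using assms by (intro finite_cartesian_product finite_UN_I) auto
qed auto

lift_definition mult_sh_hat :: "sh_hat \<Rightarrow> sh_hat \<Rightarrow> sh_hat" is mult_coeff
proof (intro conjI allI)
  fix f g :: "nat list \<Rightarrow> real" and k
  assume f: "f [] = 0 \<and> (\<forall>k. finite {w. length w = k \<and> f w \<noteq> 0})"
    and g: "g [] = 0 \<and> (\<forall>k. finite {w. length w = k \<and> g w \<noteq> 0})"
  show "mult_coeff f g [] = 0"
    unfolding mult_coeff_def using Nil_notin_basis_mult
    by (intro sum.neutral) (auto simp: not_in_iff)
  let ?P = "{(u, v). length u + length v = k + 1 \<and> f u \<noteq> 0 \<and> g v \<noteq> 0}"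
  show "finite {w. length w = k \<and> mult_coeff f g w \<noteq> 0}"
  proof (rule finite_subset)
    show "{w. length w = k \<and> mult_coeff f g w \<noteq> 0} \<subseteq> (\<Union>(u, v)\<in>?P. set_mset (basis_mult u v))"
    proof safe
      fix w assume "mult_coeff f g w \<noteq> 0" "k = length w"
      from \<open>mult_coeff f g w \<noteq> 0\<close>[unfolded mult_coeff_def] obtain p where p: "p \<in> {(u, v). length u + length v = length w + 1 \<and> f u \<noteq> 0 \<and> g v \<noteq> 0}"
        "(case p of (u, v) \<Rightarrow> f u * g v * real (count (basis_mult u v) w)) \<noteq> 0"
        by (rule sum.not_neutral_contains_not_neutral)
      obtain u v where uv: "p = (u, v)" by (cases p)
      with p(2) have "w \<in># basis_mult u v" by (auto simp flip: count_greater_zero_iff)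
      with p(1) uv \<open>k = length w\<close> show "w \<in> (\<Union>(u, v)\<in>{(u, v). length u + length v = length w + 1 \<and> f u \<noteq> 0 \<and> g v \<noteq> 0}.
          set_mset (basis_mult u v))"
        by blast
    qed
    show "finite (\<Union>(u, v)\<in>?P. set_mset (basis_mult u v))"
      using finite_mult_pairs[of f g "k + 1"] f g by (intro finite_UN_I) auto
  qed
qed

text \<open>The dual description of the product: \<open>splits w\<close> lists the pairs of complementary subwords
  of \<open>w\<close>.\<close>

fun splits :: "'a list \<Rightarrow> ('a list \<times> 'a list) multiset" where
  "splits [] = {#([], [])#}"
| "splits (c # w) = image_mset (\<lambda>(u, v). (c # u, v)) (splits w)
     + image_mset (\<lambda>(u, v). (u, c # v)) (splits w)"

definition dsum :: "('a list \<Rightarrow> 'a list \<Rightarrow> real) \<Rightarrow> 'a list \<Rightarrow> real" where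
  "dsum F w = (\<Sum>(u, v)\<in>#splits w. F u v)"

lemma dsum_Nil [simp]: "dsum F [] = F [] []"
  by (simp add: dsum_def)

lemma dsum_Cons [simp]:
  "dsum F (c # w) = dsum (\<lambda>u v. F (c # u) v) w + dsum (\<lambda>u v. F u (c # v)) w"
  by (simp add: dsum_def multiset.map_comp o_def case_prod_unfold)

lemma dsum_add: "dsum (\<lambda>u v. F u v + G u v) w = dsum F w + dsum G w"
  by (induction w arbitrary: F G) auto

lemma dsum_cmult: "dsum (\<lambda>u v. c * F u v) w = c * dsum F w"
  by (induction w arbitrary: F) (auto simp: algebra_simps)

lemma dsum_zero [simp]: "dsum (\<lambda>u v. 0) w = 0"
  by (induction w) auto

lemma dsum_sum: "dsum (\<lambda>u v. \<Sum>i\<in>A. F i u v) w = (\<Sum>i\<in>A. dsum (F i) w)"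
  by (induction w arbitrary: F) (auto simp: sum.distrib)

lemma dsum_swap: "dsum (\<lambda>u v. F v u) w = dsum F w"
proof (induction w arbitrary: F)
  case (Cons c w)
  from Cons[of "\<lambda>u v. F (c # u) v"] Cons[of "\<lambda>u v. F u (c # v)"] show ?case
    by simp
qed simp

lemma dsum_unit: "dsum (\<lambda>u v. if u = [] then h v else 0) w = h w"
  by (induction w arbitrary: h) auto

lemma dsum_assoc:
  "dsum (\<lambda>u v. dsum (\<lambda>a b. F a b v) u) w = dsum (\<lambda>u v. dsum (\<lambda>a b. F u a b) v) w"
  by (induction w arbitrary: F) (auto simp: dsum_add)

lemma count_image_Cons:
  "count (image_mset ((#) a) M) w = (case w of [] \<Rightarrow> 0 | c # w' \<Rightarrow> if a = c then count M w' else 0)"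
  by (induction M) (auto split: list.splits)

lemma count_image_Cons_fst:
  "count (image_mset (\<lambda>(u, v). (c # u, v)) M) (u, v) =
     (case u of [] \<Rightarrow> 0 | a # u' \<Rightarrow> if a = c then count M (u', v) else 0)"
  by (induction M) (auto split: list.splits)

lemma count_image_Cons_snd:
  "count (image_mset (\<lambda>(u, v). (u, c # v)) M) (u, v) =
     (case v of [] \<Rightarrow> 0 | b # v' \<Rightarrow> if b = c then count M (u, v') else 0)"
  by (induction M) (auto split: list.splits)

lemma shuffle_mset_Nil2 [simp]: "shuffle_mset u [] = {#u#}"
  by (cases u) auto

lemma count_splits: "count (splits w) (u, v) = count (shuffle_mset u v) w"
proof (induction w arbitrary: u v)
  case Nil
  show ?case
    by (cases u; cases v) (auto simp: count_image_Cons)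
next
  case (Cons c w)
  then show ?case
    by (cases u; cases v) (auto simp: count_image_Cons count_image_Cons_fst count_image_Cons_snd)
qed

lemma dsum_conv_sum:
  "dsum F w = (\<Sum>(u, v)\<in>set_mset (splits w). F u v * real (count (shuffle_mset u v) w))"
proof -
  have *: "(\<Sum>x\<in>#M. h x) = (\<Sum>x\<in>S. h x * real (count M x))"
    if "finite S" "set_mset M \<subseteq> S" for M S and h :: "'b \<Rightarrow> real"
    using that(2)
  proof (induction M)
    case (add a M)
    have "(\<Sum>x\<in>S. h x * real (count (add_mset a M) x)) =
        (\<Sum>x\<in>S. h x * real (count M x)) + (\<Sum>x\<in>S. if x = a then h x else 0)"
      unfolding sum.distrib[symmetric] by (intro sum.cong) (auto simp: algebra_simps)
    with add that(1) show ?case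
      by simp
  qed simp
  show ?thesis
    unfolding dsum_def
    by (subst *[of "set_mset (splits w)"]) (auto intro!: sum.cong simp: count_splits)
qed

lemma mem_splits: "(u, v) \<in># splits w \<longleftrightarrow> w \<in># shuffle_mset u v"
  by (simp add: count_splits flip: count_greater_zero_iff)

lemma mult_coeff_Cons:
  assumes f: "f [] = 0" "\<forall>k. finite {w. length w = k \<and> f w \<noteq> 0}"
    and g: "g [] = 0" "\<forall>k. finite {w. length w = k \<and> g w \<noteq> 0}"
  shows "mult_coeff f g (m # w) = (\<Sum>i=0..m. dsum (\<lambda>u v. f (i # u) * g ((m - i) # v)) w)"
proof -
  define h where "h = (\<lambda>(i, u, v). (i # u, (m - i :: nat) # v :: nat list))"
  let ?A = "{(u, v). length u + length v = length (m # w) + 1 \<and> f u \<noteq> 0 \<and> g v \<noteq> 0}"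
  let ?B = "{0..m} \<times> set_mset (splits w)"
  let ?t = "\<lambda>(u, v). f u * g v * real (count (basis_mult u v) (m # w))"
  have inj: "inj_on h ?B"
    by (auto simp: inj_on_def h_def)
  have t0: "?t p = 0" if "p \<in> ?A - h ` ?B" for p
  proof (rule ccontr)
    assume t: "?t p \<noteq> 0"
    obtain u v where p: "p = (u, v)" by (cases p)
    from t p have "m # w \<in># basis_mult u v" by (auto simp flip: count_greater_zero_iff)
    then obtain i u' j v' where "u = i # u'" "v = j # v'" "m = i + j" "w \<in># shuffle_mset u' v'"
      by (cases "(u, v)" rule: basis_mult.cases) auto
    then have "p = h (i, u', v')" "(i, u', v') \<in> ?B"
      by (auto simp: p h_def mem_splits)
    with that show False by blast
  qed
  have "mult_coeff f g (m # w) = sum ?t (h ` ?B)"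
    unfolding mult_coeff_def
  proof (rule sum.mono_neutral_cong)
    show "finite ?A" using f g by (intro finite_mult_pairs) auto
    show "?t p = 0" if "p \<in> h ` ?B - ?A" for p
    proof -
      from that obtain i u v where p: "p = (i # u, (m - i) # v)" "(u, v) \<in># splits w"
        by (auto simp: h_def)
      then have "length w = length u + length v"
        by (auto simp: mem_splits dest: length_shuffle_mset)
      with that p show ?thesis by auto
    qed
  qed (use t0 in auto)
  also have "\<dots> = sum (?t \<circ> h) ?B"
    by (rule sum.reindex[OF inj])
  also have "\<dots> = (\<Sum>(i, p)\<in>?B. f (i # fst p) * g ((m - i) # snd p) *
      real (count (shuffle_mset (fst p) (snd p)) w))"
    by (intro sum.cong) (auto simp: h_def count_image_Cons)
  also have "\<dots> = (\<Sum>i=0..m. dsum (\<lambda>u v. f (i # u) * g ((m - i) # v)) w)"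
    by (simp add: dsum_conv_sum case_prod_unfold sum.cartesian_product)
  finally show ?thesis .
qed

lemma tcoeff_mult:
  "tcoeff (mult_sh_hat f g) (m # w) =
     (\<Sum>i=0..m. dsum (\<lambda>u v. tcoeff f (i # u) * tcoeff g ((m - i) # v)) w)"
  by transfer (rule mult_coeff_Cons; blast)

instantiation sh_hat :: "{comm_ring_1, real_algebra_1}"
begin

definition times_sh_hat where "times_sh_hat = mult_sh_hat"

lift_definition one_sh_hat :: sh_hat is "\<lambda>w. if w = [0] then 1 else 0"
  apply (intro conjI allI)
   apply simp
  subgoal for k
    by (rule finite_subset[of _ "{[0]}"]) (auto split: if_splits)
  done

instance
proof
  fix f g h :: sh_hat and c :: real
  note [simp] = times_sh_hat_def tcoeff_mult
  have comm: "a * b = b * a" for a b :: sh_hat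
  proof (rule sh_hat_eqI)
    fix m w
    have "tcoeff (a * b) (m # w) =
        (\<Sum>i=0..m. dsum (\<lambda>u v. tcoeff a ((m - i) # u) * tcoeff b ((m - (m - i)) # v)) w)"
      unfolding times_sh_hat_def tcoeff_mult
      by (subst sum.atLeastAtMost_rev) simp
    also have "\<dots> = (\<Sum>i=0..m. dsum (\<lambda>u v. tcoeff b (i # u) * tcoeff a ((m - i) # v)) w)"
      by (intro sum.cong refl, subst dsum_swap[symmetric]) (simp add: mult.commute)
    finally show "tcoeff (a * b) (m # w) = tcoeff (b * a) (m # w)"
      by simp
  qed
  then show "f * g = g * f" .
  show "f * g * h = f * (g * h)"
  proof (rule sh_hat_eqI)
    fix m w
    let ?F = "\<lambda>i j k. dsum (\<lambda>u v. dsum (\<lambda>a b. tcoeff f (i # a) * tcoeff g (j # b) * tcoeff h (k # v)) u) w"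
    have "tcoeff (f * g * h) (m # w) = (\<Sum>j=0..m. \<Sum>i=0..j. ?F i (j - i) (m - j))"
      by (simp add: dsum_sum[symmetric] dsum_cmult[symmetric] sum_distrib_left mult.commute[of _ "tcoeff h _"])
    also have "\<dots> = (\<Sum>j=0..m. \<Sum>i=0..m - j. ?F j i (m - j - i))"
      by (rule fps_mult_assoc_lemma)
    also have "\<dots> = tcoeff (f * (g * h)) (m # w)"
      by (simp add: dsum_assoc dsum_sum[symmetric] dsum_cmult[symmetric] sum_distrib_left mult.assoc)
    finally show "tcoeff (f * g * h) (m # w) = tcoeff (f * (g * h)) (m # w)" .
  qed
  show "1 * f = f"
  proof (rule sh_hat_eqI)
    fix m w
    have one: "tcoeff 1 (i # u) = (if i = 0 \<and> u = [] then 1 else 0)" for i u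
      by transfer auto
    have "tcoeff (1 * f) (m # w) =
        (\<Sum>i=0..m. if i = 0 then dsum (\<lambda>u v. if u = [] then tcoeff f (m # v) else 0) w else 0)"
      unfolding times_sh_hat_def tcoeff_mult
      by (intro sum.cong) (auto simp: one intro!: arg_cong[where f = "\<lambda>F. dsum F w"])
    then show "tcoeff (1 * f) (m # w) = tcoeff f (m # w)"
      by (simp add: dsum_unit)
  qed
  show distrib: "(f + g) * h = f * h + g * h"
    by (rule sh_hat_eqI) (simp add: distrib_right dsum_add sum.distrib)
  show "(0::sh_hat) \<noteq> 1"
    by transfer (auto simp: fun_eq_iff)
  show scale: "c *\<^sub>R f * g = c *\<^sub>R (f * g)"
    by (rule sh_hat_eqI) (simp add: mult.assoc dsum_cmult sum_distrib_left)
  show "f * c *\<^sub>R g = c *\<^sub>R (f * g)"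
    by (rule sh_hat_eqI) (simp add: mult.left_commute dsum_cmult sum_distrib_left)
  show "f * (g + h) = f * g + f * h"
    by (rule sh_hat_eqI) (simp add: distrib_left dsum_add sum.distrib)
  show "f * 1 = f"
    using \<open>1 * f = f\<close> comm[of 1 f] by simp
qed

end

subsection \<open>Pure tensors\<close>

fun pure_coeff :: "real poly list \<Rightarrow> nat list \<Rightarrow> real" where
  "pure_coeff [] [] = 1"
| "pure_coeff (p # ps) (i # w) = poly.coeff p i * pure_coeff ps w"
| "pure_coeff _ _ = 0"

lemma pure_coeff_length: "pure_coeff ps w \<noteq> 0 \<Longrightarrow> length w = length ps"
  by (induction ps w rule: pure_coeff.induct) auto

lemma finite_pure_coeff: "finite {w. pure_coeff ps w \<noteq> 0}"
proof (induction ps)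
  case Nil
  have "w = []" if "pure_coeff [] w \<noteq> 0" for w
    using that by (cases w) auto
  then have "{w. pure_coeff [] w \<noteq> 0} \<subseteq> {[]}" by blast
  then show ?case by (rule finite_subset) simp
next
  case (Cons p ps)
  have "{w. pure_coeff (p # ps) w \<noteq> 0} \<subseteq>
      (\<lambda>(i, w). i # w) ` ({..degree p} \<times> {w. pure_coeff ps w \<noteq> 0})"
  proof
    fix w assume w: "w \<in> {w. pure_coeff (p # ps) w \<noteq> 0}"
    then obtain i w' where "w = i # w'"
      by (cases w) auto
    with w show "w \<in> (\<lambda>(i, w). i # w) ` ({..degree p} \<times> {w. pure_coeff ps w \<noteq> 0})"
      by (auto intro!: image_eqI[of _ _ "(i, w')"] le_degree)
  qed
  then show ?case
    by (rule finite_subset) (use Cons in simp)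
qed

text \<open>\<open>pure_tensor [p\<^sub>1, \<dots>, p\<^sub>k]\<close> is \<open>p\<^sub>1 \<otimes> \<dots> \<otimes> p\<^sub>k\<close>. The empty list is mapped to \<open>0\<close> as there
  is no tensor power of exponent \<open>0\<close>.\<close>

lift_definition pure_tensor :: "real poly list \<Rightarrow> sh_hat" is
  "\<lambda>ps w. if ps = [] then 0 else pure_coeff ps w"
proof (intro conjI allI)
  fix ps :: "real poly list" and k
  show "(if ps = [] then 0 else pure_coeff ps []) = 0"
    by (cases ps) auto
  show "finite {w. length w = k \<and> (if ps = [] then 0 else pure_coeff ps w) \<noteq> 0}"
    by (rule finite_subset[OF _ finite_pure_coeff[of ps]]) auto
qed

lemma tcoeff_pure_tensor: "ps \<noteq> [] \<Longrightarrow> tcoeff (pure_tensor ps) w = pure_coeff ps w"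
  by transfer simp

lemma pure_coeff_add:
  "pure_coeff (ps @ (p + q) # qs) w = pure_coeff (ps @ p # qs) w + pure_coeff (ps @ q # qs) w"
proof (induction ps arbitrary: w)
  case Nil
  show ?case by (cases w) (auto simp: distrib_right)
next
  case (Cons a ps)
  then show ?case by (cases w) (auto simp: distrib_left)
qed

lemma pure_coeff_smult: "pure_coeff (ps @ smult c p # qs) w = c * pure_coeff (ps @ p # qs) w"
proof (induction ps arbitrary: w)
  case Nil
  show ?case by (cases w) auto
next
  case (Cons a ps)
  then show ?case by (cases w) auto
qed

lemma pure_tensor_add:
  "pure_tensor (ps @ (p + q) # qs) = pure_tensor (ps @ p # qs) + pure_tensor (ps @ q # qs)"
  by (rule sh_hat_eqI) (simp add: tcoeff_pure_tensor pure_coeff_add)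

lemma pure_tensor_smult: "pure_tensor (ps @ smult c p # qs) = c *\<^sub>R pure_tensor (ps @ p # qs)"
  by (rule sh_hat_eqI) (simp add: tcoeff_pure_tensor pure_coeff_smult)

lemma pure_coeff_monom: "pure_coeff (map (monom 1) w) w' = (if w = w' then 1 else 0)"
proof (induction w arbitrary: w')
  case Nil
  show ?case by (cases w') auto
next
  case (Cons i w)
  then show ?case by (cases w') auto
qed

lemma tcoeff_sum [simp]: "tcoeff (sum F A) w = (\<Sum>a\<in>A. tcoeff (F a) w)"
  by (induction A rule: infinite_finite_induct) auto

text \<open>Elements of degree \<open>k\<close> are finite linear combinations of monomial tensors, whose
  coefficients are given by \<^const>\<open>tcoeff\<close>.\<close>

lemma homogeneous_eq_sum:
  assumes "\<And>w. tcoeff f w \<noteq> 0 \<Longrightarrow> length w = k"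
  shows "f = (\<Sum>w | length w = k \<and> tcoeff f w \<noteq> 0. tcoeff f w *\<^sub>R pure_tensor (map (monom 1) w))"
proof (rule sh_hat_eqI)
  fix m w
  let ?A = "{w. length w = k \<and> tcoeff f w \<noteq> 0}"
  have "tcoeff (\<Sum>w\<in>?A. tcoeff f w *\<^sub>R pure_tensor (map (monom 1) w)) (m # w) =
      (\<Sum>v\<in>?A. if v = m # w then tcoeff f v else 0)"
    unfolding tcoeff_sum
  proof (rule sum.cong[OF refl])
    fix v assume "v \<in> ?A"
    then have "v \<noteq> []" by auto
    then show "tcoeff (tcoeff f v *\<^sub>R pure_tensor (map (monom 1) v)) (m # w) =
        (if v = m # w then tcoeff f v else 0)"
      by (simp add: tcoeff_pure_tensor pure_coeff_monom)
  qed
  also have "\<dots> = tcoeff f (m # w)"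
    using assms[of "m # w"] by (auto simp: finite_tcoeff)
  finally show "tcoeff f (m # w) =
      tcoeff (\<Sum>w\<in>?A. tcoeff f w *\<^sub>R pure_tensor (map (monom 1) w)) (m # w)" ..
qed

lemma dsum_pure_coeff:
  "dsum (\<lambda>u v. pure_coeff a u * pure_coeff b v) w = (\<Sum>p\<in>#shuffle_mset a b. pure_coeff p w)"
proof (induction w arbitrary: a b)
  case Nil
  show ?case
    by (cases a; cases b) (auto simp: multiset.map_comp o_def)
next
  case (Cons c w)
  have *: "(\<Sum>p\<in>#M. pure_coeff (q # p) (c # w)) = poly.coeff q c * (\<Sum>p\<in>#M. pure_coeff p w)" for q M
    by (simp add: sum_mset_distrib_left)
  show ?case
  proof (cases a)
    case Nil
    with Cons[of "[]"] show ?thesis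
      by (cases b) (auto simp: mult.left_commute[of "pure_coeff _ _" "poly.coeff _ _"] dsum_cmult)
  next
    case a: (Cons p a')
    show ?thesis
    proof (cases b)
      case Nil
      with Cons[of _ "[]"] a show ?thesis
        by (auto simp: mult.assoc dsum_cmult)
    next
      case b: (Cons q b')
      show ?thesis
        using Cons[of a' b] Cons[of a b'] unfolding a b
        by (simp add: multiset.map_comp o_def mult.assoc mult.left_commute[of "pure_coeff _ _" "poly.coeff _ _"]
            dsum_cmult sum_mset_distrib_left)
    qed
  qed
qed

lemma one_eq_pure_tensor: "(1::sh_hat) = pure_tensor [1]"
proof (rule sh_hat_eqI)
  fix m w
  have "tcoeff 1 (m # w) = (if m = 0 \<and> w = [] then 1 else 0)"
    by transfer auto
  then show "tcoeff 1 (m # w) = tcoeff (pure_tensor [1]) (m # w)"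
    by (cases w) (auto simp: tcoeff_pure_tensor)
qed

theorem pure_tensor_mult:
  "pure_tensor (a0 # a) * pure_tensor (b0 # b) = (\<Sum>c\<in>#shuffle_mset a b. pure_tensor (a0 * b0 # c))"
proof (rule sh_hat_eqI)
  fix m w
  have *: "tcoeff (\<Sum>c\<in>#M. F c) v = (\<Sum>c\<in>#M. tcoeff (F c) v)" for M v and F :: "real poly list \<Rightarrow> sh_hat"
    by (induction M) auto
  have "tcoeff (pure_tensor (a0 # a) * pure_tensor (b0 # b)) (m # w) =
      (\<Sum>i=0..m. dsum (\<lambda>u v. (poly.coeff a0 i * poly.coeff b0 (m - i)) * (pure_coeff a u * pure_coeff b v)) w)"
    by (simp add: times_sh_hat_def tcoeff_mult tcoeff_pure_tensor mult_ac)
  also have "\<dots> = (\<Sum>i\<le>m. poly.coeff a0 i * poly.coeff b0 (m - i)) * (\<Sum>c\<in>#shuffle_mset a b. pure_coeff c w)"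
    by (simp add: dsum_cmult dsum_pure_coeff sum_distrib_right atMost_atLeast0)
  also have "\<dots> = tcoeff (\<Sum>c\<in>#shuffle_mset a b. pure_tensor (a0 * b0 # c)) (m # w)"
    by (simp add: * tcoeff_pure_tensor coeff_mult sum_mset_distrib_left)
  finally show "tcoeff (pure_tensor (a0 # a) * pure_tensor (b0 # b)) (m # w) =
      tcoeff (\<Sum>c\<in>#shuffle_mset a b. pure_tensor (a0 * b0 # c)) (m # w)" .
qed

text \<open>The element \<open>1 \<otimes> x \<otimes> \<dots> \<otimes> x\<close> with \<open>k\<close> factors \<open>x\<close>.\<close>

definition one_tensor_x :: "nat \<Rightarrow> sh_hat" where
  "one_tensor_x k = pure_tensor (1 # replicate k [:0, 1:])"

lemma one_tensor_x_0: "one_tensor_x 0 = 1"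
  by (simp add: one_tensor_x_def one_eq_pure_tensor)

section \<open>Filtration and topology\<close>

definition Fil :: "nat \<Rightarrow> sh_hat set" where
  "Fil k = {f. \<forall>w. length w < k \<longrightarrow> tcoeff f w = 0}"

lemma Fil_0 [simp]: "0 \<in> Fil k"
  and Fil_add: "f \<in> Fil k \<Longrightarrow> g \<in> Fil k \<Longrightarrow> f + g \<in> Fil k"
  and Fil_diff: "f \<in> Fil k \<Longrightarrow> g \<in> Fil k \<Longrightarrow> f - g \<in> Fil k"
  and Fil_antimono: "k \<le> l \<Longrightarrow> f \<in> Fil l \<Longrightarrow> f \<in> Fil k"
  by (auto simp: Fil_def)

lemma dsum_eq_0:
  "(\<And>u v. length u + length v = length w \<Longrightarrow> F u v = 0) \<Longrightarrow> dsum F w = 0"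
  by (induction w arbitrary: F) auto

lemma Fil_mult:
  assumes "f \<in> Fil k"
  shows "f * g \<in> Fil k"
  unfolding Fil_def
proof safe
  fix w :: "nat list" assume w: "length w < k"
  show "tcoeff (f * g) w = 0"
  proof (cases w)
    case (Cons m w')
    with w assms have "tcoeff f (i # u) = 0" if "length u \<le> length w'" for i u
      using that by (auto simp: Fil_def)
    with Cons show ?thesis
      by (auto simp: times_sh_hat_def tcoeff_mult intro!: sum.neutral dsum_eq_0)
  qed simp
qed

text \<open>The topology of the completion: the cosets of the \<^term>\<open>Fil k\<close> form a basis.\<close>

instantiation sh_hat :: t2_space
begin

definition open_sh_hat :: "sh_hat set \<Rightarrow> bool" where
  "open_sh_hat U \<longleftrightarrow> (\<forall>f\<in>U. \<exists>k. \<forall>g. g - f \<in> Fil k \<longrightarrow> g \<in> U)"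

lemma open_Fil_coset: "open {g. g - f \<in> Fil k}"
  unfolding open_sh_hat_def
proof
  fix h assume "h \<in> {g. g - f \<in> Fil k}"
  then have h: "h - f \<in> Fil k" by simp
  have "g - f \<in> Fil k" if "g - h \<in> Fil k" for g
    using Fil_add[OF that h] by simp
  then show "\<exists>l. \<forall>g. g - h \<in> Fil l \<longrightarrow> g \<in> {g. g - f \<in> Fil k}"
    by blast
qed

instance
proof
  show "open (UNIV :: sh_hat set)"
    by (auto simp: open_sh_hat_def)
next
  fix S T :: "sh_hat set"
  assume S: "open S" and T: "open T"
  show "open (S \<inter> T)"
    unfolding open_sh_hat_def
  proof safe
    fix f assume "f \<in> S" "f \<in> T"
    with S T obtain k l where "\<forall>g. g - f \<in> Fil k \<longrightarrow> g \<in> S" "\<forall>g. g - f \<in> Fil l \<longrightarrow> g \<in> T"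
      by (meson open_sh_hat_def)
    then show "\<exists>k. \<forall>g. g - f \<in> Fil k \<longrightarrow> g \<in> S \<inter> T"
      by (intro exI[of _ "max k l"]) (meson Fil_antimono IntI max.cobounded1 max.cobounded2)
  qed
next
  fix K :: "sh_hat set set"
  assume K: "\<forall>S\<in>K. open S"
  show "open (\<Union>K)"
    unfolding open_sh_hat_def
  proof
    fix f assume "f \<in> \<Union>K"
    then obtain S where S: "S \<in> K" "f \<in> S" by blast
    from K S(1) have "open S" by blast
    with S(2) obtain k where "\<forall>g. g - f \<in> Fil k \<longrightarrow> g \<in> S"
      unfolding open_sh_hat_def by blast
    with S show "\<exists>k. \<forall>g. g - f \<in> Fil k \<longrightarrow> g \<in> \<Union>K" by blast
  qed
next
  fix f g :: sh_hat
  assume "f \<noteq> g"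
  then obtain w where w: "tcoeff f w \<noteq> tcoeff g w"
    by (metis sh_hat_eqI)
  let ?k = "Suc (length w)"
  have "{h. h - f \<in> Fil ?k} \<inter> {h. h - g \<in> Fil ?k} = {}"
  proof safe
    fix h assume "h - f \<in> Fil ?k" "h - g \<in> Fil ?k"
    then have "tcoeff (h - f) w = 0" "tcoeff (h - g) w = 0"
      unfolding Fil_def by blast+
    with w show "h \<in> {}" by simp
  qed
  then show "\<exists>U V. open U \<and> open V \<and> f \<in> U \<and> g \<in> V \<and> U \<inter> V = {}"
    by (intro exI[of _ "{h. h - f \<in> Fil ?k}"] exI[of _ "{h. h - g \<in> Fil ?k}"])
      (auto intro: open_Fil_coset)
qed

end

lemma tendsto_sh_hat_iff:
  fixes l :: sh_hat
  shows "(f \<longlongrightarrow> l) F \<longleftrightarrow> (\<forall>k. \<forall>\<^sub>F x in F. f x - l \<in> Fil k)"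
proof
  assume f: "(f \<longlongrightarrow> l) F"
  show "\<forall>k. \<forall>\<^sub>F x in F. f x - l \<in> Fil k"
    using topological_tendstoD[OF f open_Fil_coset, of l] by simp
next
  assume f: "\<forall>k. \<forall>\<^sub>F x in F. f x - l \<in> Fil k"
  show "(f \<longlongrightarrow> l) F"
  proof (rule topological_tendstoI)
    fix S assume "open S" "l \<in> S"
    then obtain k where "\<forall>g. g - l \<in> Fil k \<longrightarrow> g \<in> S"
      by (auto simp: open_sh_hat_def)
    with f show "\<forall>\<^sub>F x in F. f x \<in> S"
      by (metis (mono_tags, lifting) eventually_mono)
  qed
qed

section \<open>Division by units\<close>

text \<open>As usual in the library, \<open>inverse\<close> is total and takes the value \<open>0\<close> on non-units.\<close>

instantiation sh_hat :: inverse
begin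

definition inverse_sh_hat :: "sh_hat \<Rightarrow> sh_hat" where
  "inverse_sh_hat f = (if f dvd 1 then THE g. f * g = 1 else 0)"

definition divide_sh_hat :: "sh_hat \<Rightarrow> sh_hat \<Rightarrow> sh_hat" where
  "divide_sh_hat f g = f * inverse g"

instance ..

end

lemma sh_hat_inverse_unique:
  fixes f g :: sh_hat
  assumes "f * g = 1"
  shows "inverse f = g"
proof -
  have h: "h = g" if "f * h = 1" for h
  proof -
    have "h = h * (f * g)" using assms by simp
    also have "\<dots> = (f * h) * g" by (simp only: mult_ac)
    finally show ?thesis using that by simp
  qed
  have "f dvd 1" using assms[symmetric] by (rule dvdI)
  then have "inverse f = (THE g. f * g = 1)" by (simp add: inverse_sh_hat_def)
  also have "\<dots> = g" using assms h by (rule the_equality)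
  finally show ?thesis .
qed

end

theory Submission
  imports Defs
begin

text \<open>Shuffling gives \<open>k! (1 \<otimes> x^\<otimes>k) = q^k\<close> for \<open>q = 1 \<otimes> x\<close>, so the three identities are classical
  theta function identities in the topologically nilpotent element \<open>q\<close>. They are all instances of the
  triple product in Ramanujan's form,
  \<open>\<Sum>\<^sub>k a^(k(k+1)/2) b^(k(k-1)/2) = \<Prod>\<^sub>i (1 + a Q^i) (1 + b Q^i) (1 - Q^(i+1))\<close> with \<open>Q = ab\<close>, which
  needs neither square roots nor inverses of \<open>q\<close>: take \<open>(a, b) = (q, q)\<close>, \<open>(q, 1)\<close> and \<open>(-q, -q^2)\<close>.
  For finite products the left-hand side acquires Gaussian binomial coefficients as weights; after
  multiplication by \<open>(Q; Q)\<^sub>n\<close> these are congruent to 1 modulo a high power of \<open>Q\<close>.\<close>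

section \<open>Gaussian binomial coefficients\<close>

fun qbinom :: "'a::comm_ring_1 \<Rightarrow> nat \<Rightarrow> nat \<Rightarrow> 'a" where
  "qbinom Q n 0 = 1"
| "qbinom Q 0 (Suc k) = 0"
| "qbinom Q (Suc n) (Suc k) = qbinom Q n k + Q ^ Suc k * qbinom Q n (Suc k)"

text \<open>The q-Pochhammer symbol (Q; Q)_n.\<close>

definition qpoch :: "'a::comm_ring_1 \<Rightarrow> nat \<Rightarrow> 'a" where
  "qpoch Q n = (\<Prod>i<n. 1 - Q ^ Suc i)"

lemma qpoch_0 [simp]: "qpoch Q 0 = 1"
  and qpoch_Suc: "qpoch Q (Suc n) = qpoch Q n * (1 - Q ^ Suc n)"
  by (simp_all add: qpoch_def)

lemma qbinom_eq_0: "n < k \<Longrightarrow> qbinom Q n k = 0"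
  by (induction Q n k rule: qbinom.induct) auto

text \<open>The mirror image of the defining recursion: both summands are expanded by the induction
  hypothesis and regrouped by the definition. It absorbs the factors 1 + a Q^m in the finite triple
  product.\<close>

lemma qbinom_Suc_Suc':
  "k \<le> n \<Longrightarrow> qbinom Q (Suc n) (Suc k) = qbinom Q n (Suc k) + Q ^ (n - k) * qbinom Q n k"
proof (induction n arbitrary: k)
  case 0
  then show ?case by simp
next
  case (Suc n)
  show ?case
  proof (cases k)
    case 0
    have "qbinom Q (Suc (Suc n)) 1 = 1 + Q * qbinom Q (Suc n) 1"
      by simp
    also have "\<dots> = 1 + Q * (qbinom Q n 1 + Q ^ n)"
      using Suc.IH[of 0] by simp
    also have "\<dots> = qbinom Q (Suc n) 1 + Q ^ Suc n"
      by (simp add: algebra_simps)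
    finally show ?thesis using 0 by simp
  next
    case k: (Suc l)
    show ?thesis
    proof (cases "k = Suc n")
      case True
      then show ?thesis by (simp add: qbinom_eq_0)
    next
      case False
      with Suc.prems k have le: "k \<le> n" "l \<le> n" by auto
      then have pow: "Q ^ (n - l) = Q ^ (n - k) * Q"
        using k by (metis Suc_diff_Suc Suc_le_lessD power_Suc2)
      have "qbinom Q (Suc (Suc n)) (Suc k) = qbinom Q (Suc n) (Suc l) + Q ^ Suc k * qbinom Q (Suc n) (Suc k)"
        using k by simp
      also have "\<dots> = (qbinom Q n k + Q ^ (n - l) * qbinom Q n l)
          + Q ^ Suc k * (qbinom Q n (Suc k) + Q ^ (n - k) * qbinom Q n k)"
        using Suc.IH[OF le(1)] Suc.IH[OF le(2)] k by simp
      also have "\<dots> = (qbinom Q n k + Q ^ Suc k * qbinom Q n (Suc k))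
          + Q ^ (n - l) * (qbinom Q n l + Q ^ k * qbinom Q n k)"
        unfolding pow by (simp add: algebra_simps)
      also have "\<dots> = qbinom Q (Suc n) (Suc k) + Q ^ (Suc n - k) * qbinom Q (Suc n) k"
        using k by simp
      finally show ?thesis .
    qed
  qed
qed

text \<open>The quotient formula for Gaussian binomials, cleared of denominators. Pascal's rule
  leaves (1 - Q^j) + Q^j (1 - Q^l), which is 1 - Q^(j + l).\<close>

lemma qbinom_mult_qpoch: "qbinom Q (j + l) j * qpoch Q j * qpoch Q l = qpoch Q (j + l)"
proof (induction "j + l" arbitrary: j l)
  case (Suc n)
  show ?case
  proof (cases "j = 0 \<or> l = 0")
    case True
    have "qbinom Q j j = 1" for j
      by (induction j) (auto simp: qbinom_eq_0)
    with True show ?thesis by auto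
  next
    case False
    then obtain j' l' where j: "j = Suc j'" and l: "l = Suc l'"
      by (meson not0_implies_Suc)
    have 1: "qbinom Q n j' * qpoch Q j' * qpoch Q l = qpoch Q n"
      using Suc.hyps(1)[of j' l] Suc.hyps(2) j by simp
    have 2: "qbinom Q n j * qpoch Q j * qpoch Q l' = qpoch Q n"
      using Suc.hyps(1)[of j l'] Suc.hyps(2) l by simp
    have "qbinom Q (j + l) j * qpoch Q j * qpoch Q l =
        (qbinom Q n j' + Q ^ j * qbinom Q n j) * qpoch Q j * qpoch Q l"
      using j Suc.hyps(2)[symmetric] by simp
    also have "\<dots> = qbinom Q n j' * (qpoch Q j' * (1 - Q ^ j)) * qpoch Q l
        + Q ^ j * qbinom Q n j * qpoch Q j * (qpoch Q l' * (1 - Q ^ l))"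
      unfolding j l qpoch_Suc[symmetric] by (simp only: distrib_right)
    also have "\<dots> = (qbinom Q n j' * qpoch Q j' * qpoch Q l) * (1 - Q ^ j)
        + Q ^ j * (qbinom Q n j * qpoch Q j * qpoch Q l') * (1 - Q ^ l)"
      by (simp only: mult_ac)
    also have "\<dots> = qpoch Q n * (1 - Q ^ Suc n)"
      unfolding 1 2 Suc.hyps(2) by (simp add: algebra_simps power_add)
    finally show ?thesis
      by (simp add: Suc.hyps(2)[symmetric] qpoch_Suc)
  qed
qed simp

section \<open>Congruences modulo powers of Q\<close>

lemma power_dvd_one_minus_cancel:
  fixes Q :: "'a::comm_ring_1"
  assumes "Q ^ e dvd (1 - Q ^ Suc i) * y"
  shows "Q ^ e dvd y"
proof -
  \<comment> \<open>\<open>1 - Q^(i+1)\<close> is a unit modulo \<open>Q^e\<close>, as it divides \<open>1 - Q^((i+1)e)\<close>.\<close>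
  have "y = (1 - (Q ^ Suc i) ^ e) * y + (Q ^ Suc i) ^ e * y"
    by (simp add: algebra_simps)
  moreover have "Q ^ e dvd (1 - (Q ^ Suc i) ^ e) * y"
    using assms by (simp only: one_diff_power_eq mult_ac) (metis dvd_mult2 mult.assoc mult.commute)
  moreover have "Q ^ e dvd (Q ^ Suc i) ^ e * y"
    by (simp add: power_mult_distrib)
  ultimately show ?thesis
    by (metis dvd_add)
qed

lemma power_dvd_qpoch_cancel: "Q ^ e dvd qpoch Q n * y \<Longrightarrow> Q ^ e dvd y"
proof (induction n arbitrary: y)
  case (Suc n)
  then show ?case
    by (metis mult.assoc power_dvd_one_minus_cancel qpoch_Suc)
qed simp

lemma power_dvd_qpoch_diff:
  assumes "r \<le> i"
  shows "Q ^ Suc r dvd qpoch Q i - qpoch Q r"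
  using assms
proof (induction rule: dec_induct)
  case (step n)
  have "qpoch Q (Suc n) - qpoch Q r = (qpoch Q n - qpoch Q r) - Q ^ Suc n * qpoch Q n"
    by (simp add: qpoch_Suc algebra_simps)
  moreover have "Q ^ Suc r dvd Q ^ Suc n * qpoch Q n"
    using step by (intro dvd_mult2 le_imp_power_dvd) simp
  ultimately show ?case
    using step by (metis dvd_diff)
qed simp

text \<open>With r = min j l, the Pochhammer symbols of j, l, j + l and N all agree with p = (Q;
  Q)_r modulo Q^(r + 1). There the quotient formula reads B p^2 = p, and p can be cancelled.\<close>

lemma power_dvd_qbinom_qpoch:
  assumes "min j l \<le> N"
  shows "Q ^ Suc (min j l) dvd qbinom Q (j + l) j * qpoch Q N - 1"
proof -
  define r where "r = min j l"
  have "\<exists>x. qpoch Q i = qpoch Q r + Q ^ Suc r * x" if "r \<le> i" for i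
    using power_dvd_qpoch_diff[OF that, of Q] by (auto simp: dvd_def algebra_simps)
  then obtain x1 x2 x3 x4 where x: "qpoch Q j = qpoch Q r + Q ^ Suc r * x1"
    "qpoch Q l = qpoch Q r + Q ^ Suc r * x2" "qpoch Q (j + l) = qpoch Q r + Q ^ Suc r * x3"
    "qpoch Q N = qpoch Q r + Q ^ Suc r * x4"
    using assms unfolding r_def by (metis min.cobounded1 min.cobounded2 trans_le_add1)
  define q p B where "q = Q ^ Suc r" and "p = qpoch Q r" and "B = qbinom Q (j + l) j"
  have "B * (p + q * x1) * (p + q * x2) = p + q * x3"
    using qbinom_mult_qpoch[of Q j l] unfolding x q_def p_def B_def .
  moreover have "p * (B * (p + q * x4) - 1) = B * (p + q * x1) * (p + q * x2) - p
      + q * (B * p * x4 - B * p * x1 - B * p * x2 - B * q * x1 * x2)"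
    by (simp add: algebra_simps)
  ultimately have "p * (B * (p + q * x4) - 1) = q * (x3 + B * p * x4 - B * p * x1 - B * p * x2 - B * q * x1 * x2)"
    by (simp add: algebra_simps)
  then have "q dvd p * (B * (p + q * x4) - 1)"
    by simp
  then show ?thesis
    unfolding q_def p_def B_def x(4)[symmetric] r_def[symmetric] by (rule power_dvd_qpoch_cancel)
qed

section \<open>The finite triple product\<close>

text \<open>Products of consecutive integers are even and nonnegative, so doubling removes both
  \<open>div\<close> and \<open>nat\<close>. Exponents are compared below in doubled form.\<close>

lemma double_nat_half:
  fixes k :: int
  shows "2 * int (nat (k * (k + 1) div 2)) = k * (k + 1)" "2 * int (nat (k * (k - 1) div 2)) = k * (k - 1)"
proof -
  have "even (k * (k + 1))" "even (k * (k - 1))" "0 \<le> k * (k + 1)" "0 \<le> k * (k - 1)"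
    by (auto simp: zero_le_mult_iff)
  then show "2 * int (nat (k * (k + 1) div 2)) = k * (k + 1)" "2 * int (nat (k * (k - 1) div 2)) = k * (k - 1)"
    by simp_all
qed

lemma abs_le_mult_self: "\<bar>k\<bar> \<le> k * (k :: int)"
  using mult_left_mono[of 1 "\<bar>k\<bar>" "\<bar>k\<bar>"] by (cases "k = 0") auto

text \<open>The terms of Ramanujan's theta function f(a, b). Both halves are nonnegative for every
  integer \<open>k\<close>, so \<open>nat\<close> cuts nothing off.\<close>

definition theta_term :: "'a::comm_ring_1 \<Rightarrow> 'a \<Rightarrow> int \<Rightarrow> 'a" where
  "theta_term a b k = a ^ nat (k * (k + 1) div 2) * b ^ nat (k * (k - 1) div 2)"

lemma theta_term_0 [simp]: "theta_term a b 0 = 1"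
  by (simp add: theta_term_def)

lemma theta_term_uminus: "theta_term a b (- k) = theta_term b a k"
proof -
  have "- k * (- k + 1) = k * (k - 1)" "- k * (- k - 1) = k * (k + 1)"
    by (simp_all add: algebra_simps)
  then show ?thesis
    unfolding theta_term_def by (simp only: mult.commute)
qed

lemma theta_term_Suc: "theta_term a b (int i + 1) = a * (a * b) ^ i * theta_term a b (int i)"
proof -
  have cancel: "x = y" if "2 * int x = 2 * int y" for x y
    using that by simp
  have "nat ((int i + 1) * (int i + 1 + 1) div 2) = nat (int i * (int i + 1) div 2) + (i + 1)"
    "nat ((int i + 1) * (int i + 1 - 1) div 2) = nat (int i * (int i - 1) div 2) + i"
    by (rule cancel, unfold of_nat_add distrib_left double_nat_half, simp add: algebra_simps)+
  then show ?thesis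
    unfolding theta_term_def by (simp only: power_add power_one_right power_mult_distrib mult_ac)
qed

text \<open>Formally, consecutive terms have the quotient a Q^k, and Q^(m - k) clears its negative
  powers. For negative \<open>k\<close> the quotient is read backwards, through the reflected
  terms.\<close>

lemma theta_term_step:
  assumes "k \<le> int m"
  shows "a * (a * b) ^ m * theta_term a b k = (a * b) ^ nat (int m - k) * theta_term a b (k + 1)"
proof (cases "k \<ge> 0")
  case True
  then obtain i where i: "k = int i"
    using nonneg_int_cases by blast
  with assms have "m = nat (int m - k) + i"
    by simp
  then have "(a * b) ^ m = (a * b) ^ nat (int m - k) * (a * b) ^ i"
    by (metis power_add)
  then show ?thesis
    using i by (simp add: theta_term_Suc mult_ac)
next
  case False
  define i where "i = nat (- k - 1)"
  with False have k: "k = - (int i + 1)" "k + 1 = - int i"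
    by auto
  have "nat (int m - k) = m + i + 1"
    using k by simp
  moreover have "theta_term a b k = b * (a * b) ^ i * theta_term a b (k + 1)"
    unfolding k(2) unfolding k(1) theta_term_uminus theta_term_Suc by (simp add: mult.commute)
  ultimately show ?thesis
    by (simp add: power_add mult_ac)
qed

lemma theta_term_step':
  assumes "0 \<le> int n + k"
  shows "b * (a * b) ^ n * theta_term a b k = (a * b) ^ nat (int n + k) * theta_term a b (k - 1)"
  using theta_term_step[of "- k" n b a] assms theta_term_uminus[of b a k] theta_term_uminus[of b a "k - 1"]
  by (simp add: mult.commute)

text \<open>The coefficient with lower index n + 1 vanishes, so the shifted sum keeps its range and
  Pascal's rule applies term by term.\<close>

lemma sum_qbinom_shift:
  "(\<Sum>j\<le>n. qbinom Q n j * h j) = h 0 + (\<Sum>j\<le>n. qbinom Q n (Suc j) * h (Suc j))"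
proof -
  have "(\<Sum>j\<le>n. qbinom Q n j * h j) = (\<Sum>j\<le>Suc n. qbinom Q n j * h j)"
    by (simp add: qbinom_eq_0)
  also have "\<dots> = h 0 + (\<Sum>j\<le>n. qbinom Q n (Suc j) * h (Suc j))"
    by (subst sum.atMost_Suc_shift) simp
  finally show ?thesis .
qed

text \<open>First \<open>m\<close> grows with \<open>n = 0\<close>, then \<open>n\<close>. A new
  factor 1 + a Q^m moves theta indices up, and the mirrored Pascal rule merges neighbouring weights;
  a new factor 1 + b Q^n moves them down, and the defining recursion merges.\<close>

lemma finite_triple_product:
  fixes a b :: "'a::comm_ring_1"
  shows "(\<Prod>i<m. 1 + a * (a * b) ^ i) * (\<Prod>i<n. 1 + b * (a * b) ^ i) =
    (\<Sum>j\<le>m + n. qbinom (a * b) (m + n) j * theta_term a b (int j - int n))"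
proof (induction n)
  case 0
  show ?case
  proof (induction m)
    case (Suc m)
    let ?Q = "a * b" and ?c = "theta_term a b"
    have "(\<Prod>i<Suc m. 1 + a * ?Q ^ i) * (\<Prod>i<0. 1 + b * ?Q ^ i)
        = (\<Sum>j\<le>m. qbinom ?Q m j * ?c (int j)) * (1 + a * ?Q ^ m)"
      using Suc by simp
    also have "\<dots> = (\<Sum>j\<le>m. qbinom ?Q m j * ?c (int j)) + (\<Sum>j\<le>m. qbinom ?Q m j * (a * ?Q ^ m * ?c (int j)))"
      by (simp add: distrib_left sum_distrib_right sum_distrib_left sum.distrib mult_ac)
    also have "(\<Sum>j\<le>m. qbinom ?Q m j * (a * ?Q ^ m * ?c (int j)))
        = (\<Sum>j\<le>m. ?Q ^ (m - j) * qbinom ?Q m j * ?c (int (Suc j)))"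
    proof (intro sum.cong refl)
      fix j assume "j \<in> {..m}"
      then have "a * ?Q ^ m * ?c (int j) = ?Q ^ (m - j) * ?c (int (Suc j))"
        by (subst theta_term_step) (auto simp: add.commute nat_diff_distrib)
      then show "qbinom ?Q m j * (a * ?Q ^ m * ?c (int j)) = ?Q ^ (m - j) * qbinom ?Q m j * ?c (int (Suc j))"
        by (simp only: mult_ac)
    qed
    also have "(\<Sum>j\<le>m. qbinom ?Q m j * ?c (int j)) = 1 + (\<Sum>j\<le>m. qbinom ?Q m (Suc j) * ?c (int (Suc j)))"
      by (subst sum_qbinom_shift) simp
    also have "1 + (\<Sum>j\<le>m. qbinom ?Q m (Suc j) * ?c (int (Suc j)))
        + (\<Sum>j\<le>m. ?Q ^ (m - j) * qbinom ?Q m j * ?c (int (Suc j)))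
        = 1 + (\<Sum>j\<le>m. qbinom ?Q (Suc m) (Suc j) * ?c (int (Suc j)))"
      unfolding add.assoc sum.distrib[symmetric]
      by (intro arg_cong2[where f = "(+)"] sum.cong refl)
        (simp add: qbinom_Suc_Suc' distrib_right del: qbinom.simps of_nat_Suc)
    also have "\<dots> = (\<Sum>j\<le>Suc m. qbinom ?Q (Suc m) j * ?c (int j))"
      by (subst sum.atMost_Suc_shift) simp
    finally show ?case
      by simp
  qed simp
next
  case (Suc n)
  let ?Q = "a * b" and ?c = "theta_term a b" and ?N = "m + n"
  have "(\<Prod>i<m. 1 + a * ?Q ^ i) * (\<Prod>i<Suc n. 1 + b * ?Q ^ i)
      = (\<Sum>j\<le>?N. qbinom ?Q ?N j * ?c (int j - int n)) * (1 + b * ?Q ^ n)"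
    using Suc by (simp add: mult.assoc[symmetric])
  also have "\<dots> = (\<Sum>j\<le>?N. qbinom ?Q ?N j * ?c (int j - int n))
      + (\<Sum>j\<le>?N. qbinom ?Q ?N j * (b * ?Q ^ n * ?c (int j - int n)))"
    by (simp add: distrib_left sum_distrib_right sum_distrib_left sum.distrib mult_ac)
  also have "(\<Sum>j\<le>?N. qbinom ?Q ?N j * (b * ?Q ^ n * ?c (int j - int n)))
      = (\<Sum>j\<le>?N. qbinom ?Q ?N j * (?Q ^ j * ?c (int j - int (Suc n))))"
  proof (intro sum.cong refl)
    fix j assume "j \<in> {..?N}"
    have "b * ?Q ^ n * ?c (int j - int n) = ?Q ^ j * ?c (int j - int (Suc n))"
      by (subst theta_term_step') (auto simp: algebra_simps)
    then show "qbinom ?Q ?N j * (b * ?Q ^ n * ?c (int j - int n)) = qbinom ?Q ?N j * (?Q ^ j * ?c (int j - int (Suc n)))"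
      by (simp only:)
  qed
  \<comment> \<open>The term \<open>j = 0\<close> becomes the new lowest index; the others line up
    again with the unshifted sum.\<close>
  also have "\<dots> = ?c (- int (Suc n)) + (\<Sum>j\<le>?N. ?Q ^ Suc j * qbinom ?Q ?N (Suc j) * ?c (int j - int n))"
    by (subst sum_qbinom_shift) (simp add: mult_ac)
  also have "(\<Sum>j\<le>?N. qbinom ?Q ?N j * ?c (int j - int n)) + (?c (- int (Suc n))
      + (\<Sum>j\<le>?N. ?Q ^ Suc j * qbinom ?Q ?N (Suc j) * ?c (int j - int n)))
      = ?c (- int (Suc n)) + (\<Sum>j\<le>?N. qbinom ?Q (Suc ?N) (Suc j) * ?c (int (Suc j) - int (Suc n)))"
    by (simp add: distrib_right sum.distrib)
  also have "\<dots> = (\<Sum>j\<le>Suc ?N. qbinom ?Q (Suc ?N) j * ?c (int j - int (Suc n)))"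
    by (subst sum.atMost_Suc_shift) simp
  finally show ?case
    by simp
qed

text \<open>The weights times (Q; Q)_N are known to be 1 only modulo Q^(min(j, m + n - j) + 1),
  which is weak near both ends of the range. By the hypothesis on \<open>d\<close> the theta terms
  make up for it there; the one on \<open>N\<close> bounds the minimum as
  \<open>power_dvd_qbinom_qpoch\<close> demands.\<close>

lemma triple_product_dvd:
  fixes a b :: "'a::comm_ring_1"
  assumes N: "m + n \<le> 2 * N + 1"
    and d: "\<And>j. j \<le> m + n \<Longrightarrow> d dvd (a * b) ^ Suc (min j (m + n - j)) * theta_term a b (int j - int n)"
  shows "d dvd (\<Prod>i<m. 1 + a * (a * b) ^ i) * (\<Prod>i<n. 1 + b * (a * b) ^ i) * qpoch (a * b) N
    - (\<Sum>k\<in>{- int n..int m}. theta_term a b k)"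
proof -
  let ?Q = "a * b" and ?c = "\<lambda>j. theta_term a b (int j - int n)"
  have "(\<Sum>k\<in>{- int n..int m}. theta_term a b k) = (\<Sum>j\<le>m + n. ?c j)"
    by (rule sum.reindex_bij_witness[of _ "\<lambda>j. int j - int n" "\<lambda>k. nat (k + int n)"]) auto
  then have "(\<Prod>i<m. 1 + a * ?Q ^ i) * (\<Prod>i<n. 1 + b * ?Q ^ i) * qpoch ?Q N
      - (\<Sum>k\<in>{- int n..int m}. theta_term a b k)
      = (\<Sum>j\<le>m + n. (qbinom ?Q (m + n) j * qpoch ?Q N - 1) * ?c j)"
    by (simp add: finite_triple_product sum_distrib_right sum_subtractf left_diff_distrib) (simp only: mult_ac)
  also have "d dvd \<dots>"
  proof (rule dvd_sum)
    fix j assume "j \<in> {..m + n}"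
    then have j: "j \<le> m + n" by simp
    with N have "min j (m + n - j) \<le> N" by auto
    from power_dvd_qbinom_qpoch[OF this, of ?Q] j
    have "?Q ^ Suc (min j (m + n - j)) dvd qbinom ?Q (m + n) j * qpoch ?Q N - 1" by simp
    then show "d dvd (qbinom ?Q (m + n) j * qpoch ?Q N - 1) * ?c j"
      using d[OF j] by (meson dvd_trans dvd_refl mult_dvd_mono)
  qed
  finally show ?thesis .
qed

section \<open>Convergence in the completion\<close>

lemma Fil_sum: "(\<And>i. i \<in> A \<Longrightarrow> f i \<in> Fil k) \<Longrightarrow> sum f A \<in> Fil k"
  by (induction A rule: infinite_finite_induct) (auto intro: Fil_add)

text \<open>Carries the congruences over to the topology: with \<open>power_x_gen_Fil\<close>,
  divisibility by q^k puts a difference into \<open>Fil k\<close>.\<close>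

lemma Fil_dvd: "f \<in> Fil k \<Longrightarrow> f dvd g \<Longrightarrow> g \<in> Fil k"
  by (auto simp: Fil_mult)

lemma eq_if_diff_Fil:
  assumes "\<And>k. f - g \<in> Fil k"
  shows "f = g"
proof (rule sh_hat_eqI)
  fix m w
  from assms[of "Suc (length (m # w))"] have "tcoeff (f - g) (m # w) = 0"
    unfolding Fil_def by blast
  then show "tcoeff f (m # w) = tcoeff g (m # w)" by simp
qed

text \<open>Completeness. All words of length k read their coefficient from the same member
  \<open>s (Suc k)\<close>, where it has become stationary, so the support in each degree stays
  finite.\<close>

lemma exists_limit:
  fixes s :: "nat \<Rightarrow> sh_hat"
  assumes "\<And>k l. k \<le> l \<Longrightarrow> s l - s k \<in> Fil k"
  obtains S where "\<And>k. s k - S \<in> Fil k"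
proof -
  define g where "g = (\<lambda>w. tcoeff (s (Suc (length w))) w)"
  have "g \<in> {f. f [] = 0 \<and> (\<forall>k. finite {w. length w = k \<and> f w \<noteq> 0})}"
  proof safe
    fix k
    have "{w. length w = k \<and> g w \<noteq> 0} = {w. length w = k \<and> tcoeff (s (Suc k)) w \<noteq> 0}"
      by (auto simp: g_def)
    then show "finite {w. length w = k \<and> g w \<noteq> 0}"
      by (simp add: finite_tcoeff)
  qed (simp add: g_def)
  then have g: "tcoeff (Abs_sh_hat g) w = g w" for w
    by (simp add: Abs_sh_hat_inverse)
  have "s k - Abs_sh_hat g \<in> Fil k" for k
    unfolding Fil_def
  proof safe
    fix w :: "nat list" assume "length w < k"
    then have "s k - s (Suc (length w)) \<in> Fil (Suc (length w))"
      by (intro assms) simp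
    then have "tcoeff (s k - s (Suc (length w))) w = 0"
      unfolding Fil_def by blast
    then show "tcoeff (s k - Abs_sh_hat g) w = 0"
      by (simp add: g) (simp add: g_def)
  qed
  then show ?thesis by (rule that)
qed

text \<open>Sums over finite supersets of \<open>A k\<close> agree modulo \<open>Fil k\<close>,
  which is the Cauchy condition for unordered sums.\<close>

lemma exists_has_sum:
  fixes f :: "'i \<Rightarrow> sh_hat"
  assumes fin: "\<And>k. finite (A k)" and f: "\<And>k i. i \<notin> A k \<Longrightarrow> f i \<in> Fil k"
  obtains S where "(f has_sum S) UNIV" "\<And>k. sum f (A k) - S \<in> Fil k"
proof -
  have *: "sum f X - sum f (A k) \<in> Fil k" if "finite X" "A k \<subseteq> X" for X k
    using that f by (subst sum_diff[symmetric]) (auto intro: Fil_sum)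
  \<comment> \<open>The unions increase with \<open>k\<close>, so later sums differ from earlier
    ones only by terms in \<open>Fil k\<close>, as \<open>exists_limit\<close> requires.\<close>
  define B where "B k = (\<Union>i\<le>k. A i)" for k
  have B: "finite (B k)" "A k \<subseteq> B k" for k
    using fin by (auto simp: B_def)
  have Bf: "sum f (B k) - sum f (A k) \<in> Fil k" for k
    using B by (rule *)
  have "sum f (B l) - sum f (B k) \<in> Fil k" if "k \<le> l" for k l
  proof -
    have "A k \<subseteq> B l"
      using that by (auto simp: B_def)
    from Fil_diff[OF *[OF B(1) this] Bf[of k]] show ?thesis
      by simp
  qed
  from exists_limit[of "\<lambda>k. sum f (B k)", OF this]
  obtain S where S: "\<And>k. sum f (B k) - S \<in> Fil k"
    by blast
  have AS: "sum f (A k) - S \<in> Fil k" for k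
    using Fil_diff[OF S[of k] Bf[of k]] by simp
  have "sum f X - S \<in> Fil k" if "finite X" "A k \<subseteq> X" for X k
    using Fil_add[OF *[OF that] AS[of k]] by simp
  then have "\<exists>X. finite X \<and> X \<subseteq> UNIV \<and> (\<forall>Y. finite Y \<and> X \<subseteq> Y \<and> Y \<subseteq> UNIV \<longrightarrow> sum f Y - S \<in> Fil k)" for k
    using fin by (intro exI[of _ "A k"]) auto
  then have "(f has_sum S) UNIV"
    unfolding has_sum_def tendsto_sh_hat_iff eventually_finite_subsets_at_top by (rule allI)
  then show ?thesis
    using AS by (rule that)
qed

text \<open>The word \<open>[0]\<close> arises only from the product of \<open>[0]\<close> with
  itself, so this coefficient is multiplicative. It will detect that a limit is nonzero.\<close>

lemma tcoeff_mult_0: "tcoeff (f * g) [0] = tcoeff f [0] * tcoeff g [0]"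
  by (simp add: times_sh_hat_def tcoeff_mult)

lemma tcoeff_one_0 [simp]: "tcoeff 1 [0] = 1"
  by transfer simp

lemma tcoeff_prod_0: "tcoeff (\<Prod>i\<in>A. f i) [0] = (\<Prod>i\<in>A. tcoeff (f i) [0])"
  by (induction A rule: infinite_finite_induct) (auto simp: tcoeff_mult_0)

lemma tcoeff_power_0: "tcoeff (f ^ n) [0] = tcoeff f [0] ^ n"
  by (induction n) (auto simp: tcoeff_mult_0)

lemma has_sum_has_prod:
  fixes f :: "'i \<Rightarrow> sh_hat" and g :: "nat \<Rightarrow> sh_hat"
  assumes "\<And>k. finite (A k)" "\<And>k i. i \<notin> A k \<Longrightarrow> f i \<in> Fil k"
    and g: "\<And>k. (\<Prod>i<k. g i) - sum f (A k) \<in> Fil k" "\<And>i. tcoeff (g i) [0] = 1"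
  shows "\<exists>S. (f has_sum S) UNIV \<and> g has_prod S"
proof -
  obtain S where S: "(f has_sum S) UNIV" "\<And>k. sum f (A k) - S \<in> Fil k"
    using exists_has_sum[of A f] assms(1,2) by blast
  have PS: "(\<Prod>i<k. g i) - S \<in> Fil k" for k
    using Fil_add[OF g(1)[of k] S(2)[of k]] by simp
  have "(\<Prod>i\<le>n. g i) - S \<in> Fil k" if "k \<le> n" for n k
    using PS[of "Suc n"] that Fil_antimono[of k "Suc n"] by (simp add: lessThan_Suc_atMost)
  then have "(\<lambda>n. \<Prod>i\<le>n. g i) \<longlonglongrightarrow> S"
    unfolding tendsto_sh_hat_iff eventually_sequentially by blast
  \<comment> \<open>Convergence of the product from index 0 includes a nonzero limit. Modulo
    \<open>Fil 2\<close> the limit is the product of the first two factors, and the word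
    \<open>[0]\<close>, of length 1, still sees it.\<close>
  moreover have "S \<noteq> 0"
  proof
    assume "S = 0"
    with PS[of 2] have "tcoeff (\<Prod>i<2. g i) [0] = 0"
      by (simp add: Fil_def)
    then show False
      by (simp add: tcoeff_prod_0 g(2))
  qed
  ultimately have "g has_prod S"
    by (simp add: has_prod_def raw_has_prod_def)
  with S(1) show ?thesis by blast
qed

section \<open>Powers of \<open>1 \<otimes> x\<close>\<close>

definition x_gen :: sh_hat where "x_gen = one_tensor_x 1"

text \<open>A further letter fits into k + 1 places, always with the same result; these
  multiplicities are the source of the factorials.\<close>

lemma shuffle_mset_replicate:
  "shuffle_mset [a] (replicate k a) = replicate_mset (Suc k) (replicate (Suc k) a)"
proof (induction k)
  case (Suc k)
  have "shuffle_mset [a] (replicate (Suc k) a)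
      = add_mset (a # replicate (Suc k) a) (image_mset ((#) a) (shuffle_mset [a] (replicate k a)))"
    by simp
  then show ?case
    unfolding Suc by (simp add: image_replicate_mset)
qed simp

lemma fact_one_tensor_x: "fact k *\<^sub>R one_tensor_x k = x_gen ^ k"
proof (induction k)
  case (Suc k)
  have sum_replicate: "(\<Sum>c\<in>#replicate_mset n y. h c) = real n *\<^sub>R h y"
    for n y and h :: "real poly list \<Rightarrow> sh_hat"
    by (induction n) (auto simp: scaleR_add_left)
  have "x_gen * one_tensor_x k = real (Suc k) *\<^sub>R one_tensor_x (Suc k)"
    using pure_tensor_mult[of 1 "[[:0, 1:]]" 1 "replicate k [:0, 1:]"]
    unfolding shuffle_mset_replicate sum_replicate by (simp add: x_gen_def one_tensor_x_def)
  then have "x_gen * (fact k *\<^sub>R one_tensor_x k) = fact (Suc k) *\<^sub>R one_tensor_x (Suc k)"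
    by (simp add: mult.commute)
  then show ?case
    using Suc by simp
qed (simp add: one_tensor_x_0)

text \<open>Topological nilpotence: q^n is a multiple of a tensor with n + 1 factors.\<close>

lemma power_x_gen_Fil:
  assumes "k \<le> n"
  shows "x_gen ^ n \<in> Fil k"
proof -
  have "pure_coeff (1 # replicate n [:0, 1:]) w = 0" if "length w < k" for w
    using pure_coeff_length[of "1 # replicate n [:0, 1:]" w] that assms by auto
  then show ?thesis
    unfolding fact_one_tensor_x[symmetric] Fil_def one_tensor_x_def by (simp add: tcoeff_pure_tensor)
qed

lemma tcoeff_x_gen_0: "tcoeff x_gen [0] = 0"
  by (simp add: x_gen_def one_tensor_x_def tcoeff_pure_tensor)

text \<open>The geometric series in q^n converges, so 1 - q^n is a unit and \<open>inverse\<close>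
  does not take its default value 0.\<close>

lemma one_minus_power_x_gen_inverse:
  assumes "0 < n"
  shows "(1 - x_gen ^ n) * inverse (1 - x_gen ^ n) = 1"
proof -
  have geom: "(x_gen ^ n) ^ l \<in> Fil k" if "k \<le> l" for k l
  proof -
    have "l \<le> n * l" using assms by simp
    with that show ?thesis
      unfolding power_mult[symmetric] by (intro power_x_gen_Fil) linarith
  qed
  then obtain S where S: "\<And>k. (\<Sum>i<k. (x_gen ^ n) ^ i) - S \<in> Fil k"
    using exists_has_sum[of lessThan "\<lambda>i. (x_gen ^ n) ^ i"] by (metis finite_lessThan lessThan_iff not_less)
  have "1 - (1 - x_gen ^ n) * S \<in> Fil k" for k
  proof -
    have "((\<Sum>i<k. (x_gen ^ n) ^ i) - S) * (1 - x_gen ^ n) \<in> Fil k"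
      by (rule Fil_mult[OF S])
    then have "(1 - (x_gen ^ n) ^ k) - (1 - x_gen ^ n) * S \<in> Fil k"
      unfolding one_diff_power_eq by (simp add: algebra_simps)
    then have "((1 - (x_gen ^ n) ^ k) - (1 - x_gen ^ n) * S) + (x_gen ^ n) ^ k \<in> Fil k"
      by (intro Fil_add geom order_refl)
    then show ?thesis by simp
  qed
  then have "(1 - x_gen ^ n) * S = 1"
    using eq_if_diff_Fil by metis
  then show ?thesis
    using sh_hat_inverse_unique by blast
qed

section \<open>The identities\<close>

text \<open>The case a = b = q with Q = q^2: the two exponents of a theta term add up to
  k^2.\<close>

lemma square_identity:
  "\<exists>S. ((\<lambda>n::int. x_gen ^ nat (n\<^sup>2)) has_sum S) UNIV \<and>
     (\<lambda>n. (1 + x_gen ^ (2 * n + 1))\<^sup>2 * (1 - x_gen ^ (2 * n + 2))) has_prod S"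
proof (rule has_sum_has_prod[where A = "\<lambda>k. {- int k..int k}"])
  have c: "theta_term x_gen x_gen k = x_gen ^ nat (k\<^sup>2)" for k
  proof -
    define A B where "A = nat (k * (k + 1) div 2)" and "B = nat (k * (k - 1) div 2)"
    have "2 * int A = k * (k + 1)" "2 * int B = k * (k - 1)"
      by (simp_all only: A_def B_def double_nat_half)
    then have "int (A + B) = k\<^sup>2"
      by (simp add: power2_eq_square algebra_simps)
    then have "A + B = nat (k\<^sup>2)"
      by (metis nat_int)
    then show ?thesis
      unfolding theta_term_def A_def[symmetric] B_def[symmetric] by (simp flip: power_add)
  qed
  fix k
  show "x_gen ^ nat (i\<^sup>2) \<in> Fil k" if "i \<notin> {- int k..int k}" for i
  proof (rule power_x_gen_Fil)
    have "int k \<le> \<bar>i\<bar>" using that by auto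
    also have "\<dots> \<le> i * i" by (rule abs_le_mult_self)
    finally show "k \<le> nat (i\<^sup>2)" by (simp add: power2_eq_square le_nat_iff)
  qed
  have "(\<Prod>i<k. (1 + x_gen ^ (2 * i + 1))\<^sup>2 * (1 - x_gen ^ (2 * i + 2)))
      = (\<Prod>i<k. 1 + x_gen * (x_gen * x_gen) ^ i) * (\<Prod>i<k. 1 + x_gen * (x_gen * x_gen) ^ i) * qpoch (x_gen * x_gen) k"
    unfolding qpoch_def prod.distrib[symmetric]
    by (intro prod.cong refl) (simp add: power_mult power2_eq_square mult.assoc)
  moreover have "x_gen ^ k dvd (\<Prod>i<k. 1 + x_gen * (x_gen * x_gen) ^ i) * (\<Prod>i<k. 1 + x_gen * (x_gen * x_gen) ^ i)
      * qpoch (x_gen * x_gen) k - (\<Sum>j\<in>{- int k..int k}. theta_term x_gen x_gen j)"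
  proof (rule triple_product_dvd)
    fix j assume j: "j \<le> k + k"
    have "(x_gen * x_gen) ^ Suc (min j (k + k - j)) * theta_term x_gen x_gen (int j - int k)
        = x_gen ^ (2 * Suc (min j (k + k - j)) + nat ((int j - int k)\<^sup>2))"
      unfolding c by (simp only: power_add power_mult power2_eq_square)
    \<comment> \<open>The weight error supplies 2 (r + 1) and the theta term i^2, which is at least
      |i| = k - r.\<close>
    moreover have "k \<le> 2 * Suc (min j (k + k - j)) + nat ((int j - int k)\<^sup>2)"
    proof -
      define i r where "i = int j - int k" and "r = min j (k + k - j)"
      have "\<bar>i\<bar> \<le> i\<^sup>2"
        using abs_le_mult_self[of i] by (simp add: power2_eq_square)
      moreover have "int r = int k - \<bar>i\<bar>"
        using j by (auto simp: i_def r_def)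
      ultimately have "int k \<le> int (2 * Suc r) + i\<^sup>2"
        by simp
      also have "\<dots> = int (2 * Suc r + nat (i\<^sup>2))"
        by simp
      finally show ?thesis
        unfolding i_def r_def by (simp only: of_nat_le_iff)
    qed
    ultimately show "x_gen ^ k dvd (x_gen * x_gen) ^ Suc (min j (k + k - j)) * theta_term x_gen x_gen (int j - int k)"
      by (simp only: le_imp_power_dvd)
  qed simp
  ultimately have "x_gen ^ k dvd (\<Prod>i<k. (1 + x_gen ^ (2 * i + 1))\<^sup>2 * (1 - x_gen ^ (2 * i + 2)))
      - (\<Sum>j\<in>{- int k..int k}. theta_term x_gen x_gen j)"
    by (simp only:)
  then show "(\<Prod>i<k. (1 + x_gen ^ (2 * i + 1))\<^sup>2 * (1 - x_gen ^ (2 * i + 2)))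
      - (\<Sum>i\<in>{- int k..int k}. x_gen ^ nat (i\<^sup>2)) \<in> Fil k"
    unfolding c using power_x_gen_Fil[OF order_refl] Fil_dvd by blast
  show "tcoeff ((1 + x_gen ^ (2 * k + 1))\<^sup>2 * (1 - x_gen ^ (2 * k + 2))) [0] = 1"
    by (simp add: tcoeff_mult_0 tcoeff_power_0 tcoeff_x_gen_0)
qed simp

text \<open>Sorts the factors 1 - Q^i by i modulo 3, which recognizes the triple product for a = -Q,
  b = -Q^2 as a single Pochhammer symbol.\<close>

lemma qpoch_triple:
  "qpoch Q (3 * n) = (\<Prod>i<n. 1 - Q * (Q ^ 3) ^ i) * (\<Prod>i<n. 1 - Q\<^sup>2 * (Q ^ 3) ^ i) * qpoch (Q ^ 3) n"
proof (induction n)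
  case (Suc n)
  have "3 * Suc n = Suc (Suc (Suc (3 * n)))"
    by simp
  then have "qpoch Q (3 * Suc n)
      = qpoch Q (3 * n) * (1 - Q ^ (3 * n + 1)) * (1 - Q ^ (3 * n + 2)) * (1 - Q ^ (3 * n + 3))"
    by (simp only: qpoch_Suc) (simp add: eval_nat_numeral)
  moreover have "Q ^ (3 * n + 1) = Q * (Q ^ 3) ^ n" "Q ^ (3 * n + 2) = Q\<^sup>2 * (Q ^ 3) ^ n"
    "Q ^ (3 * n + 3) = (Q ^ 3) ^ Suc n"
    unfolding power_add power_mult by (simp_all add: mult.commute)
  ultimately show ?case
    unfolding Suc by (simp only: qpoch_Suc prod.lessThan_Suc mult_ac)
qed simp

text \<open>The case a = -q, b = -q^2 with Q = q^3.\<close>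

lemma pentagonal_identity:
  "\<exists>S. ((\<lambda>n::int. (- 1) powi n *\<^sub>R x_gen ^ nat (n * (3 * n - 1) div 2)) has_sum S) UNIV \<and>
     (\<lambda>n. 1 - x_gen ^ (n + 1)) has_prod S"
proof (rule has_sum_has_prod[where A = "\<lambda>k. {- int k..int k}"])
  let ?e = "\<lambda>i::int. nat (i * (3 * i - 1) div 2)"
  let ?c = "theta_term (- x_gen) (- (x_gen\<^sup>2))"
  have c: "?c i = (- 1) powi i *\<^sub>R x_gen ^ ?e i" for i
  proof -
    define A B where "A = nat (i * (i + 1) div 2)" and "B = nat (i * (i - 1) div 2)"
    have "2 * int A = i * (i + 1)" "2 * int B = i * (i - 1)"
      by (simp_all only: A_def B_def double_nat_half)
    \<comment> \<open>The parity of \<open>A + B\<close> gives the sign, and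
      \<open>A + 2 * B\<close> is the power of q.\<close>
    then have "int (A + B) = i * i" "2 * int (A + 2 * B) = i * (3 * i - 1)"
      by (simp_all add: algebra_simps)
    then have parity: "even (A + B) \<longleftrightarrow> even i" and e: "?e i = A + 2 * B"
      by (metis even_mult_iff even_of_nat, metis nat_int nonzero_mult_div_cancel_left zero_neq_numeral)
    have "?c i = (- 1) ^ (A + B) * x_gen ^ (A + 2 * B)"
      unfolding theta_term_def A_def[symmetric] B_def[symmetric]
        power_minus[of x_gen] power_minus[of "x_gen\<^sup>2"] power_add power_mult by (simp only: mult_ac)
    also have "\<dots> = (- 1) powi i *\<^sub>R x_gen ^ (A + 2 * B)"
      using parity by (cases "even i") (simp_all add: power_int_minus_left)
    finally show ?thesis
      unfolding e .
  qed
  have e: "\<bar>i\<bar> \<le> int (?e i)" for i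
  proof -
    have "2 * \<bar>i\<bar> \<le> i * (3 * i - 1)"
      using abs_le_mult_self[of i] by (simp add: algebra_simps)
    then show ?thesis
      by linarith
  qed
  fix k
  show "(- 1) powi i *\<^sub>R x_gen ^ ?e i \<in> Fil k" if "i \<notin> {- int k..int k}" for i
  proof -
    have "int k \<le> \<bar>i\<bar>"
      using that by auto
    also note e
    finally have "k \<le> ?e i"
      by (simp only: of_nat_le_iff)
    from power_x_gen_Fil[OF this] show ?thesis
      by (auto simp: Fil_def)
  qed
  have Q: "(- x_gen) * (- (x_gen\<^sup>2)) = x_gen ^ 3"
    by (simp add: eval_nat_numeral)
  have "x_gen ^ k dvd (\<Prod>i<k. 1 + (- x_gen) * ((- x_gen) * (- (x_gen\<^sup>2))) ^ i)
      * (\<Prod>i<k. 1 + (- (x_gen\<^sup>2)) * ((- x_gen) * (- (x_gen\<^sup>2))) ^ i)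
      * qpoch ((- x_gen) * (- (x_gen\<^sup>2))) k - (\<Sum>i\<in>{- int k..int k}. ?c i)"
  proof (rule triple_product_dvd)
    fix j assume j: "j \<le> k + k"
    define r where "r = min j (k + k - j)"
    have "int r = int k - \<bar>int j - int k\<bar>"
      using j by (auto simp: r_def)
    then have "int k \<le> int (3 * Suc r) + t" if "\<bar>int j - int k\<bar> \<le> t" for t
      using that by simp
    from this[OF e] have "k \<le> 3 * Suc r + ?e (int j - int k)"
      by (metis of_nat_add of_nat_le_iff)
    then have "x_gen ^ k dvd (x_gen ^ 3) ^ Suc r * x_gen ^ ?e (int j - int k)"
      unfolding power_mult[symmetric] power_add[symmetric] by (rule le_imp_power_dvd)
    \<comment> \<open>The sign is a real scalar; written as a multiple of 1 it becomes a further
      factor.\<close>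
    then show "x_gen ^ k dvd ((- x_gen) * (- (x_gen\<^sup>2))) ^ Suc (min j (k + k - j)) * ?c (int j - int k)"
      unfolding Q c r_def by (metis dvd_mult2 mult_scaleR_right mult_scaleR_left mult.right_neutral)
  qed simp
  then have "x_gen ^ k dvd qpoch x_gen (3 * k) - (\<Sum>i\<in>{- int k..int k}. ?c i)"
    unfolding Q by (simp add: qpoch_triple)
  \<comment> \<open>The triple product has 3k factors 1 - q^i, the partial product only the first k;
    the surplus ones are 1 modulo q^k.\<close>
  moreover have "x_gen ^ k dvd qpoch x_gen (3 * k) - qpoch x_gen k"
    using power_dvd_qpoch_diff[of k "3 * k" x_gen] by (rule power_le_dvd) simp_all
  ultimately have "x_gen ^ k dvd (qpoch x_gen (3 * k) - (\<Sum>i\<in>{- int k..int k}. ?c i)) - (qpoch x_gen (3 * k) - qpoch x_gen k)"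
    by (rule dvd_diff)
  then have "x_gen ^ k dvd qpoch x_gen k - (\<Sum>i\<in>{- int k..int k}. ?c i)"
    by simp
  then show "(\<Prod>i<k. 1 - x_gen ^ (i + 1)) - (\<Sum>i\<in>{- int k..int k}. (- 1) powi i *\<^sub>R x_gen ^ ?e i) \<in> Fil k"
    unfolding c qpoch_def Suc_eq_plus1 using power_x_gen_Fil[OF order_refl] Fil_dvd by blast
  show "tcoeff (1 - x_gen ^ (k + 1)) [0] = 1"
    by (simp add: tcoeff_mult_0 tcoeff_power_0 tcoeff_x_gen_0)
qed simp

text \<open>The case a = q, b = 1 with Q = q gives 2 E^2 (q; q)_k = 2 T modulo \<open>Fil k\<close>.
  The left 2 is the factor 1 + b Q^0; the right one arises because i and -i - 1 share a triangular
  exponent. Here E^2 (q; q)_k is \<open>A * E\<close>, and replacing E by I gives the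
  quotient.\<close>

lemma triangular_identity:
  "\<exists>S. ((\<lambda>n::nat. x_gen ^ (Suc n choose 2)) has_sum S) UNIV \<and>
     (\<lambda>n. (1 - x_gen ^ (2 * n + 2)) / (1 - x_gen ^ (2 * n + 1))) has_prod S"
proof (rule has_sum_has_prod[where A = atMost])
  have inv: "(1 - x_gen ^ (2 * n + 1)) * inverse (1 - x_gen ^ (2 * n + 1)) = 1" for n
    by (rule one_minus_power_x_gen_inverse) simp
  fix k :: nat
  show "x_gen ^ (Suc i choose 2) \<in> Fil k" if "i \<notin> {..k}" for i
    using that by (intro power_x_gen_Fil) (simp add: numeral_2_eq_2)
  show "tcoeff ((1 - x_gen ^ (2 * k + 2)) / (1 - x_gen ^ (2 * k + 1))) [0] = 1"
    using arg_cong[OF inv[of k], of "\<lambda>f. tcoeff f [0]"]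
    by (simp add: divide_sh_hat_def tcoeff_mult_0 tcoeff_power_0 tcoeff_x_gen_0)
  define A B E I where "A = (\<Prod>i<k. 1 - x_gen ^ (2 * i + 2))" and "B = (\<Prod>i<k. 1 - x_gen ^ (2 * i + 1))"
    and "E = (\<Prod>i<k. 1 + x_gen ^ (i + 1))" and "I = (\<Prod>i<k. inverse (1 - x_gen ^ (2 * i + 1)))"
  define T where "T = (\<Sum>i\<le>k. x_gen ^ (Suc i choose 2))"
  have BI: "B * I = 1"
    unfolding B_def I_def prod.distrib[symmetric] by (simp only: inv prod.neutral_const)
  \<comment> \<open>Each factor splits as 1 - q^(2i) = (1 - q^i) (1 + q^i).\<close>
  have A: "A = qpoch x_gen k * E"
    unfolding A_def qpoch_def E_def prod.distrib[symmetric]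
    by (intro prod.cong refl) (simp add: algebra_simps flip: power_add mult_2)
  have "qpoch x_gen (2 * k) = B * A"
    unfolding A_def B_def by (induction k) (simp_all add: qpoch_Suc mult_ac)
  then have "qpoch x_gen (2 * k) - qpoch x_gen k = qpoch x_gen k * (B * E - 1)"
    unfolding A by (simp add: algebra_simps)
  then have "x_gen ^ Suc k dvd qpoch x_gen k * (B * E - 1)"
    using power_dvd_qpoch_diff[of k "2 * k" x_gen] by simp
  \<comment> \<open>Euler: the product \<open>E\<close> of the \<open>1 + q^i\<close> inverts the product \<open>B\<close> of the \<open>1 - q^(2i-1)\<close>.\<close>
  then have "x_gen ^ k dvd B * E - 1"
    using power_dvd_qpoch_cancel power_le_dvd by (metis le_add2 plus_1_eq_Suc)
  moreover have "A * E - A * I = (B * E - 1) * (A * I)"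
  proof -
    have "(B * E - 1) * (A * I) = A * E * (B * I) - A * I"
      by (simp add: algebra_simps)
    then show ?thesis
      by (simp add: BI)
  qed
  ultimately have "x_gen ^ k dvd A * E - A * I"
    by simp
  then have 1: "A * E - A * I \<in> Fil k"
    using power_x_gen_Fil[OF order_refl] Fil_dvd by blast

  let ?e = "\<lambda>i::int. nat (i * (i + 1) div 2)"
  \<comment> \<open>Taking k + 1 factors for b leaves k beside the factor 2 and makes the range of
    indices symmetric under i to -1 - i.\<close>
  have "x_gen ^ k dvd (\<Prod>i<k. 1 + x_gen * (x_gen * 1) ^ i) * (\<Prod>i<k + 1. 1 + 1 * (x_gen * 1) ^ i) * qpoch (x_gen * 1) k
      - (\<Sum>i\<in>{- int (k + 1)..int k}. theta_term x_gen 1 i)"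
  proof (rule triple_product_dvd)
    fix j assume j: "j \<le> k + (k + 1)"
    define i where "i = int j - int (k + 1)"
    \<comment> \<open>These inequalities say that i (i + 1) / 2 is at least i and at least -i -
      1.\<close>
    have "0 \<le> i * (i - 1)" "0 \<le> (i + 1) * (i + 2)"
      by (auto simp: zero_le_mult_iff)
    then have "2 * i \<le> 2 * int (?e i)" "2 * (- i - 1) \<le> 2 * int (?e i)"
      unfolding double_nat_half by (auto simp: algebra_simps)
    then have "i \<le> int (?e i)" "- i - 1 \<le> int (?e i)"
      by simp_all
    moreover have "int k \<le> int (Suc (min j (k + (k + 1) - j))) + t" if "i \<le> t" "- i - 1 \<le> t" for t
      using that j i_def by linarith
    ultimately have "k \<le> Suc (min j (k + (k + 1) - j)) + ?e i"
      by (metis of_nat_add of_nat_le_iff)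
    then show "x_gen ^ k dvd (x_gen * 1) ^ Suc (min j (k + (k + 1) - j)) * theta_term x_gen 1 (int j - int (k + 1))"
      unfolding theta_term_def i_def[symmetric] power_one mult_1_right power_add[symmetric]
      by (rule le_imp_power_dvd)
  qed simp
  moreover have "(\<Prod>i<k + 1. 1 + 1 * (x_gen * 1) ^ i) = 2 * E"
    unfolding E_def Suc_eq_plus1[symmetric] by (subst prod.lessThan_Suc_shift) simp
  moreover have "(\<Prod>i<k. 1 + x_gen * (x_gen * 1) ^ i) = E"
    unfolding E_def by simp
  moreover have "(\<Sum>i\<in>{- int (k + 1)..int k}. theta_term x_gen 1 i) = 2 * T"
  proof -
    have e: "?e (int i) = Suc i choose 2" "?e (- int i - 1) = Suc i choose 2" for i
    proof -
      have "int i * (int i + 1) = int (Suc i * i)" "(- int i - 1) * (- int i - 1 + 1) = int (Suc i * i)"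
        by (simp_all add: algebra_simps)
      then have "int i * (int i + 1) div 2 = int (Suc i choose 2)"
        "(- int i - 1) * (- int i - 1 + 1) div 2 = int (Suc i choose 2)"
        by (simp_all only: choose_two diff_Suc_1 zdiv_int of_nat_numeral)
      then show "?e (int i) = Suc i choose 2" "?e (- int i - 1) = Suc i choose 2"
        by simp_all
    qed
    have "{- int (k + 1)..int k} = {0..int k} \<union> {- int k - 1.. - 1}"
      by auto
    then have "(\<Sum>i\<in>{- int (k + 1)..int k}. theta_term x_gen 1 i)
        = (\<Sum>i\<in>{0..int k}. x_gen ^ ?e i) + (\<Sum>i\<in>{- int k - 1.. - 1}. x_gen ^ ?e i)"
      by (simp add: sum.union_disjoint theta_term_def)
    also have "(\<Sum>i\<in>{0..int k}. x_gen ^ ?e i) = T"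
      unfolding T_def by (rule sum.reindex_bij_witness[of _ int nat]) (auto simp: e simp flip: e(1))
    also have "(\<Sum>i\<in>{- int k - 1.. - 1}. x_gen ^ ?e i) = T"
      unfolding T_def
      by (rule sum.reindex_bij_witness[of _ "\<lambda>i. - int i - 1" "\<lambda>i. nat (- i - 1)"]) (auto simp flip: e(2))
    finally show ?thesis
      by simp
  qed
  ultimately have "x_gen ^ k dvd E * (2 * E) * qpoch x_gen k - 2 * T"
    by simp
  also have "E * (2 * E) * qpoch x_gen k - 2 * T = (A * E - T) + (A * E - T)"
    unfolding A by (simp add: algebra_simps)
  finally have "(A * E - T) + (A * E - T) \<in> Fil k"
    using power_x_gen_Fil[OF order_refl] Fil_dvd by blast
  moreover have "f \<in> Fil k" if "f + f \<in> Fil k" for f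
    using that unfolding Fil_def mem_Collect_eq tcoeff_simps by simp
  ultimately have "A * E - T \<in> Fil k"
    by blast
  from Fil_diff[OF this 1] have "A * I - T \<in> Fil k"
    by simp
  then show "(\<Prod>i<k. (1 - x_gen ^ (2 * i + 2)) / (1 - x_gen ^ (2 * i + 1))) - (\<Sum>i\<le>k. x_gen ^ (Suc i choose 2)) \<in> Fil k"
    unfolding A_def I_def T_def divide_sh_hat_def prod.distrib .
qed simp

theorem theorem4p2:
  shows
    "(\<exists>S::sh_hat.
        ((\<lambda>n::int. fact (nat (n^2)) *\<^sub>R one_tensor_x (nat (n^2))) has_sum S) UNIV \<and>
        (\<lambda>n::nat. (1 + fact (2 * (n + 1) - 1) *\<^sub>R one_tensor_x (2 * (n + 1) - 1))^2 *
                  (1 - fact (2 * (n + 1)) *\<^sub>R one_tensor_x (2 * (n + 1)))) has_prod S) \<and>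
     (\<exists>S::sh_hat.
        ((\<lambda>n::nat. fact ((n + 1) choose 2) *\<^sub>R one_tensor_x ((n + 1) choose 2)) has_sum S) UNIV \<and>
        (\<lambda>n::nat. (1 - fact (2 * (n + 1)) *\<^sub>R one_tensor_x (2 * (n + 1))) /
                  (1 - fact (2 * (n + 1) - 1) *\<^sub>R one_tensor_x (2 * (n + 1) - 1))) has_prod S) \<and>
     (\<exists>S::sh_hat.
        ((\<lambda>n::int. ((-1) powi n * fact (nat (n * (3 * n - 1) div 2))) *\<^sub>R
                   one_tensor_x (nat (n * (3 * n - 1) div 2))) has_sum S) UNIV \<and>
        (\<lambda>n::nat. 1 - fact (n + 1) *\<^sub>R one_tensor_x (n + 1)) has_prod S)"
proof -
  \<comment> \<open>Aligns the exponents. Reversing \<open>scaleR_scaleR\<close> then separates the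
    sign from the factorial, so that \<open>fact_one_tensor_x\<close> applies.\<close>
  have exps: "2 * (n + 1) - 1 = 2 * n + 1" "2 * (n + 1) = 2 * n + 2" "n + 1 = Suc n" for n :: nat
    by simp_all
  show ?thesis
    using square_identity triangular_identity pentagonal_identity
    unfolding scaleR_scaleR[symmetric] fact_one_tensor_x exps by simp
qed

end
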